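(* Let $m,n>1$ be integers. Let $X=\mathbb{Z}/(m)\times \mathbb{Z}/(n)\times \mathbb{Z}/(m)$. For $(a,b,c)\in X$ consider the permutation $\sigma_{(a,b,c)}$ of $X$ defined by $$\sigma_{(a,b,c)}(x,y,z)=\bigl(x-c,\;y-1,\;z-\delta_{(a,b),(x-c,y-1)}\bigr)$$ for all $a,c,x,z\in\mathbb{Z}/(m)$ and $b,y\in\mathbb{Z}/(n)$. Let $r\colon X\times X\to X\times X$ be the map defined by $$r((a,b,c),(x,y,z))=\bigl(\sigma_{(a,b,c)}(x,y,z),\ \sigma^{-1}_{\sigma_{(a,b,c)}(x,y,z)}(a,b,c)\bigr)$$ for all $(a,b,c),(x,y,z)\in X$. Then $(X,r)$ is an indecomposable and irretractable solution of the YBE. Furthermore, the map $f\colon X\to \mathbb{Z}/(n)$ defined by $f(a,b,c)=b$ for all $(a,b,c)\in X$ is an epimorphism of solutions from $(X,r)$ to $(\mathbb{Z}/(n),s)$, where $s(i,j)=(j-1,i+1)$ for all $i,j\in\mathbb{Z}/(n)$.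
   Context: A solution of the YBE means an involutive, non-degenerate, set-theoretic solution of the Yang--Baxter equation: a pair $(X,r)$ where $X$ is a non-empty set and $r\colon X\times X\to X\times X$ is a map, written $r(x,y)=(\sigma_x(y),\gamma_y(x))$, such that $r^2=\mathrm{id}$, all maps $\sigma_x,\gamma_y\colon X\to X$ are bijective, and $r_{12}r_{23}r_{12}=r_{23}r_{12}r_{23}$ on $X^3$, where $r_{12}=r\times \mathrm{id}_X$ and $r_{23}=\mathrm{id}_X\times r$. The permutation group of $(X,r)$ is the subgroup $\mathcal{G}(X,r)$ of the symmetric group on $X$ generated by all $\sigma_x$, $x\in X$. The solution $(X,r)$ is indecomposable if $\mathcal{G}(X,r)$ acts transitively on $X$. It is irretractable if $\sigma_x\neq\sigma_y$ for all distinct $x,y\in X$. A homomorphism of solutions $f\colon (X,r)\to (Y,s)$, with $r(x,y)=(\sigma_x(y),\gamma_y(x))$ and $s(t,z)=(\sigma'_t(z),\gamma'_z(t))$, is a map $f\colon X\to Y$ such that $f(\sigma_x(y))=\sigma'_{f(x)}(f(y))$ and $f(\gamma_y(x))=\gamma'_{f(y)}(f(x))$ for all $x,y\in X$. An epimorphism is a surjective homomorphism. $\delta_{u,v}$ is the Kronecker delta ($1$ if $u=v$, $0$ otherwise), here regarded as an element of $\mathbb{Z}/(m)$. *)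

theory Defs
  imports "HOL-Algebra.Group_Action" "HOL-Algebra.Generated_Groups" "HOL-Number_Theory.Residues"
begin

text \<open>
  A solution is a carrier set together with a map \<open>r\<close> on pairs, written
  \<open>r (x, y) = (\<sigma>\<^sub>x(y), \<gamma>\<^sub>y(x))\<close>. Only the values of \<open>r\<close> on \<open>X \<times> X\<close> matter. The component maps are
  made extensional on \<open>X\<close>, so that equality of them means equality as maps on \<open>X\<close> and they can
  be elements of the symmetric group \<^const>\<open>BijGroup\<close>.
\<close>

definition ybe_sigma :: "'a set \<Rightarrow> ('a \<times> 'a \<Rightarrow> 'a \<times> 'a) \<Rightarrow> 'a \<Rightarrow> 'a \<Rightarrow> 'a" where
  "ybe_sigma X r x = (\<lambda>y\<in>X. fst (r (x, y)))"

definition ybe_gamma :: "'a set \<Rightarrow> ('a \<times> 'a \<Rightarrow> 'a \<times> 'a) \<Rightarrow> 'a \<Rightarrow> 'a \<Rightarrow> 'a" where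
  "ybe_gamma X r y = (\<lambda>x\<in>X. snd (r (x, y)))"

definition ybe12 :: "('a \<times> 'a \<Rightarrow> 'a \<times> 'a) \<Rightarrow> 'a \<times> 'a \<times> 'a \<Rightarrow> 'a \<times> 'a \<times> 'a" where
  "ybe12 r = (\<lambda>(x, y, z). (fst (r (x, y)), snd (r (x, y)), z))"

definition ybe23 :: "('a \<times> 'a \<Rightarrow> 'a \<times> 'a) \<Rightarrow> 'a \<times> 'a \<times> 'a \<Rightarrow> 'a \<times> 'a \<times> 'a" where
  "ybe23 r = (\<lambda>(x, y, z). (x, r (y, z)))"

definition ybe_solution :: "'a set \<Rightarrow> ('a \<times> 'a \<Rightarrow> 'a \<times> 'a) \<Rightarrow> bool" where
  "ybe_solution X r \<longleftrightarrow>
     X \<noteq> {} \<and>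
     r \<in> X \<times> X \<rightarrow> X \<times> X \<and>
     (\<forall>p\<in>X \<times> X. r (r p) = p) \<and>
     (\<forall>x\<in>X. bij_betw (ybe_sigma X r x) X X) \<and>
     (\<forall>y\<in>X. bij_betw (ybe_gamma X r y) X X) \<and>
     (\<forall>t\<in>X \<times> X \<times> X. ybe12 r (ybe23 r (ybe12 r t)) = ybe23 r (ybe12 r (ybe23 r t)))"

definition permutation_group ::
    "'a set \<Rightarrow> ('a \<times> 'a \<Rightarrow> 'a \<times> 'a) \<Rightarrow> ('a \<Rightarrow> 'a) monoid" where
  "permutation_group X r =
     BijGroup X \<lparr>carrier := generate (BijGroup X) (ybe_sigma X r ` X)\<rparr>"

definition ybe_indecomposable :: "'a set \<Rightarrow> ('a \<times> 'a \<Rightarrow> 'a \<times> 'a) \<Rightarrow> bool" where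
  "ybe_indecomposable X r \<longleftrightarrow> transitive_action (permutation_group X r) X (\<lambda>g. g)"

definition ybe_irretractable :: "'a set \<Rightarrow> ('a \<times> 'a \<Rightarrow> 'a \<times> 'a) \<Rightarrow> bool" where
  "ybe_irretractable X r \<longleftrightarrow>
     (\<forall>x\<in>X. \<forall>y\<in>X. x \<noteq> y \<longrightarrow> ybe_sigma X r x \<noteq> ybe_sigma X r y)"

definition ybe_homomorphism ::
    "'a set \<Rightarrow> ('a \<times> 'a \<Rightarrow> 'a \<times> 'a) \<Rightarrow> 'b set \<Rightarrow> ('b \<times> 'b \<Rightarrow> 'b \<times> 'b) \<Rightarrow> ('a \<Rightarrow> 'b) \<Rightarrow> bool" where
  "ybe_homomorphism X r Y s f \<longleftrightarrow>
     ybe_solution X r \<and> ybe_solution Y s \<and> f \<in> X \<rightarrow> Y \<and>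
     (\<forall>x\<in>X. \<forall>y\<in>X.
        f (ybe_sigma X r x y) = ybe_sigma Y s (f x) (f y) \<and>
        f (ybe_gamma X r y x) = ybe_gamma Y s (f y) (f x))"

definition ybe_epimorphism ::
    "'a set \<Rightarrow> ('a \<times> 'a \<Rightarrow> 'a \<times> 'a) \<Rightarrow> 'b set \<Rightarrow> ('b \<times> 'b \<Rightarrow> 'b \<times> 'b) \<Rightarrow> ('a \<Rightarrow> 'b) \<Rightarrow> bool" where
  "ybe_epimorphism X r Y s f \<longleftrightarrow> ybe_homomorphism X r Y s f \<and> f ` X = Y"

text \<open>
  \<open>\<int>/(m)\<close> is rendered as \<^const>\<open>residue_ring\<close>, with carrier \<open>{0..m - 1}\<close> and arithmetic modulo \<open>m\<close>.
\<close>

definition kron :: "int \<Rightarrow> 'b \<Rightarrow> 'b \<Rightarrow> int" where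
  "kron m u v = (if u = v then \<one>\<^bsub>residue_ring m\<^esub> else \<zero>\<^bsub>residue_ring m\<^esub>)"

definition XX :: "int \<Rightarrow> int \<Rightarrow> (int \<times> int \<times> int) set" where
  "XX m n = carrier (residue_ring m) \<times> carrier (residue_ring n) \<times> carrier (residue_ring m)"

definition sig :: "int \<Rightarrow> int \<Rightarrow> int \<times> int \<times> int \<Rightarrow> int \<times> int \<times> int \<Rightarrow> int \<times> int \<times> int" where
  "sig m n = (\<lambda>(a, b, c) (x, y, z).
     (x \<ominus>\<^bsub>residue_ring m\<^esub> c,
      y \<ominus>\<^bsub>residue_ring n\<^esub> \<one>\<^bsub>residue_ring n\<^esub>,
      z \<ominus>\<^bsub>residue_ring m\<^esub>
        kron m (a, b) (x \<ominus>\<^bsub>residue_ring m\<^esub> c, y \<ominus>\<^bsub>residue_ring n\<^esub> \<one>\<^bsub>residue_ring n\<^esub>)))"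

text \<open>
  The inverse of \<open>sig m n w\<close> is taken as a map on \<open>XX m n\<close>. That \<open>sig m n w\<close> permutes \<open>XX m n\<close> is
  part of \<open>ybe_solution (XX m n) (rr m n)\<close>, as its restriction is \<open>ybe_sigma (XX m n) (rr m n) w\<close>.
\<close>

definition rr :: "int \<Rightarrow> int \<Rightarrow>
    (int \<times> int \<times> int) \<times> (int \<times> int \<times> int) \<Rightarrow> (int \<times> int \<times> int) \<times> (int \<times> int \<times> int)" where
  "rr m n = (\<lambda>(u, v). (sig m n u v, inv_into (XX m n) (sig m n (sig m n u v)) u))"

definition ss :: "int \<Rightarrow> int \<times> int \<Rightarrow> int \<times> int" where
  "ss n = (\<lambda>(i, j). (j \<ominus>\<^bsub>residue_ring n\<^esub> \<one>\<^bsub>residue_ring n\<^esub>, i \<oplus>\<^bsub>residue_ring n\<^esub> \<one>\<^bsub>residue_ring n\<^esub>))"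

end

theory Submission
  imports Defs
begin

text \<open>
  The map \<open>rr m n\<close> lifts along \<open>\<int>\<^sup>3 \<rightarrow> \<int>/(m) \<times> \<int>/(n) \<times> \<int>/(m)\<close> to
  \<open>((a, b, c), (x, y, z)) \<mapsto> ((x - c, y - 1, z - d), (a + z - d, b + 1, c + d))\<close> with
  \<open>d = D (a + c - x) (b + 1 - y)\<close>, where \<open>D\<close> is the indicator function of \<open>m\<int> \<times> n\<int>\<close>.
  The lift is an involution and satisfies the braid relation for every function
  \<open>D : \<int> \<times> \<int> \<rightarrow> \<int>\<close>, because the three values of \<open>D\<close> that occur on either side of the relation
  have the same arguments. Bijectivity of the component maps uses that \<open>D\<close> is periodic.
  For indecomposability, a suitable \<open>\<sigma>\<^sub>w\<close> moves \<open>(x, y, z)\<close> to \<open>(x', y - 1, z - e)\<close> for any \<open>x'\<close>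
  and \<open>e \<in> {0, 1}\<close>, and such moves connect any two points.
\<close>

text \<open>Composing the maps along a chain yields an element of the generated group, so
  transitivity can be shown with positive words alone.\<close>

lemma ybe_indecomposableI:
  assumes sol: "ybe_solution X r"
    and reach: "\<And>x y. x \<in> X \<Longrightarrow> y \<in> X \<Longrightarrow> (\<lambda>x y. \<exists>w\<in>X. y = ybe_sigma X r w x)\<^sup>*\<^sup>* x y"
  shows "ybe_indecomposable X r"
proof -
  let ?S = "ybe_sigma X r ` X" and ?B = "BijGroup X"
  have Bij: "ybe_sigma X r w \<in> Bij X" if "w \<in> X" for w
    using sol that by (auto simp: ybe_solution_def Bij_def ybe_sigma_def)
  then have S: "?S \<subseteq> carrier ?B"
    by (auto simp: BijGroup_def)
  interpret B: group ?B by (rule group_BijGroup)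
  have sub: "subgroup (generate ?B ?S) ?B"
    by (rule B.generate_is_subgroup[OF S])
  have "group_hom (permutation_group X r) ?B (\<lambda>g. g)"
    using B.canonical_inj_is_hom[OF sub] by (simp add: permutation_group_def id_def)
  moreover have "\<exists>g\<in>carrier (permutation_group X r). g x = y" if x: "x \<in> X" and y: "y \<in> X" for x y
    using reach[OF x y]
  proof (induction rule: rtranclp_induct)
    case base
    have "\<one>\<^bsub>?B\<^esub> \<in> generate ?B ?S" by (rule generate.one)
    moreover have "\<one>\<^bsub>?B\<^esub> x = x" using x by (simp add: BijGroup_def)
    ultimately show ?case by (auto simp: permutation_group_def)
  next
    case (step y z)
    then obtain g w where g: "g \<in> generate ?B ?S" "g x = y" and w: "w \<in> X" "z = ybe_sigma X r w y"
      by (auto simp: permutation_group_def)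
    have "g \<in> Bij X" using B.generate_incl[OF S] g(1) by (auto simp: BijGroup_def)
    then have "(ybe_sigma X r w \<otimes>\<^bsub>?B\<^esub> g) x = z"
      using g w x Bij by (simp add: BijGroup_def compose_eq)
    moreover have "ybe_sigma X r w \<otimes>\<^bsub>?B\<^esub> g \<in> generate ?B ?S"
      using g(1) w(1) by (auto intro: generate.eng generate.incl)
    ultimately show ?case by (auto simp: permutation_group_def)
  qed
  ultimately show ?thesis
    by (simp add: ybe_indecomposable_def transitive_action_def group_action_def
        transitive_action_axioms_def)
qed

section \<open>Computation with integer representatives\<close>

context
  fixes m n :: int
  assumes m: "m > 1" and n: "n > 1"
begin

definition proj :: "int \<times> int \<times> int \<Rightarrow> int \<times> int \<times> int" where
  "proj = (\<lambda>(a, b, c). (a mod m, b mod n, c mod m))"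

definition dlt :: "int \<Rightarrow> int \<Rightarrow> int" where
  "dlt s t = (if m dvd s \<and> n dvd t then 1 else 0)"

lemma residue_ring_minus:
  assumes "k > 1"
  shows "x \<ominus>\<^bsub>residue_ring k\<^esub> y = (x - y) mod k"
proof -
  interpret residues k "residue_ring k" by unfold_locales (use assms in auto)
  show ?thesis
    by (simp add: a_minus_def res_neg_eq) (simp add: residue_ring_def mod_simps)
qed

lemma XX_eq_range: "XX m n = range proj"
proof -
  have "p = proj p" if "p \<in> XX m n" for p
    using that by (auto simp: XX_def proj_def residue_ring_def)
  moreover have "proj p \<in> XX m n" for p
    using m n by (auto simp: XX_def proj_def residue_ring_def split: prod.split)
  ultimately show ?thesis by auto
qed

lemma proj_in_XX [simp]: "proj p \<in> XX m n"
  by (simp add: XX_eq_range)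

lemma XX_cases:
  assumes "p \<in> XX m n"
  obtains a b c where "p = proj (a, b, c)"
  using assms by (auto simp: XX_eq_range)

lemma finite_XX: "finite (XX m n)"
  by (simp add: XX_def residue_ring_def)

lemma proj_eq_iff:
  "proj (a, b, c) = proj (a', b', c') \<longleftrightarrow> m dvd a - a' \<and> n dvd b - b' \<and> m dvd c - c'"
  by (simp add: proj_def mod_eq_dvd_iff)

lemma dlt_cong:
  assumes "m dvd s - s'" "n dvd t - t'"
  shows "dlt s t = dlt s' t'"
  using assms by (metis dlt_def dvd_diff_right_iff dvd_diff_left_iff)

lemma sig_proj:
  "sig m n (proj (a, b, c)) (proj (x, y, z)) = proj (x - c, y - 1, z - dlt (a + c - x) (b + 1 - y))"
proof -
  have "a mod m = (x - c) mod m \<longleftrightarrow> m dvd a + c - x" "b mod n = (y - 1) mod n \<longleftrightarrow> n dvd b + 1 - y"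
    by (simp_all add: mod_eq_dvd_iff algebra_simps)
  then have "kron m (a mod m, b mod n) ((x - c) mod m, (y - 1) mod n) = dlt (a + c - x) (b + 1 - y)"
    by (simp add: kron_def dlt_def residue_ring_def)
  moreover have "\<one>\<^bsub>residue_ring n\<^esub> = 1" by (simp add: residue_ring_def)
  ultimately show ?thesis
    using m n by (simp add: sig_def proj_def residue_ring_minus mod_simps)
qed

text \<open>The first two coordinates of the image determine \<open>x\<close> and \<open>y\<close>;
  these fix the delta term, and then the last coordinate determines \<open>z\<close>.\<close>

lemma inj_on_sig:
  assumes "u \<in> XX m n"
  shows "inj_on (sig m n u) (XX m n)"
proof (rule inj_onI)
  fix v v' assume "v \<in> XX m n" "v' \<in> XX m n" and eq: "sig m n u v = sig m n u v'"
  then obtain a b c x y z x' y' z'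
    where p: "u = proj (a, b, c)" "v = proj (x, y, z)" "v' = proj (x', y', z')"
    using assms by (elim XX_cases)
  have xy: "m dvd x - x'" "n dvd y - y'"
    using eq by (simp_all add: p sig_proj proj_eq_iff)
  have "dlt (a + c - x) (b + 1 - y) = dlt (a + c - x') (b + 1 - y')"
    by (rule dlt_cong) (use xy in \<open>simp_all add: dvd_diff_commute\<close>)
  then show "v = v'"
    using eq xy by (simp add: p sig_proj proj_eq_iff)
qed

text \<open>The second component is confirmed by exhibiting a preimage under \<open>sig\<close>,
  which injectivity identifies with the value of \<open>inv_into\<close>.\<close>

lemma rr_proj:
  fixes a b c x y z :: int
  defines "d \<equiv> dlt (a + c - x) (b + 1 - y)"
  shows "rr m n (proj (a, b, c), proj (x, y, z)) =
    (proj (x - c, y - 1, z - d), proj (a + z - d, b + 1, c + d))"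
proof -
  have *: "inv_into (XX m n) (sig m n (proj (x - c, y - 1, z - d))) (proj (a, b, c)) =
      proj (a + z - d, b + 1, c + d)"
  proof (rule inv_into_f_eq)
    \<comment> \<open>Both arguments are the negatives of those in \<open>d\<close>, and
      \<open>dlt\<close> is even.\<close>
    have "dlt (x - c + (z - d) - (a + z - d)) (y - 1 + 1 - (b + 1)) = d"
      unfolding d_def dlt_def by (simp add: dvd_diff_commute algebra_simps)
    then show "sig m n (proj (x - c, y - 1, z - d)) (proj (a + z - d, b + 1, c + d)) = proj (a, b, c)"
      by (simp add: sig_proj)
  qed (simp_all add: inj_on_sig)
  show ?thesis
    using * by (simp add: rr_def sig_proj d_def)
qed

section \<open>The solution axioms\<close>

lemma rr_involutive: "rr m n (rr m n (proj (a, b, c), proj (x, y, z))) = (proj (a, b, c), proj (x, y, z))"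
proof -
  define d where "d = dlt (a + c - x) (b + 1 - y)"
  have "dlt (x - c + (z - d) - (a + z - d)) (y - 1 + 1 - (b + 1)) = d"
    unfolding d_def dlt_def by (simp add: dvd_diff_commute algebra_simps)
  then show ?thesis
    by (simp add: rr_proj flip: d_def)
qed

lemma rr_braid:
  "ybe12 (rr m n) (ybe23 (rr m n) (ybe12 (rr m n) (proj (a, b, c), proj (x, y, z), proj (p, q, s)))) =
   ybe23 (rr m n) (ybe12 (rr m n) (ybe23 (rr m n) (proj (a, b, c), proj (x, y, z), proj (p, q, s))))"
  by (simp add: ybe12_def ybe23_def rr_proj algebra_simps)

lemma ybe_sigma_rr:
  "ybe_sigma (XX m n) (rr m n) (proj (a, b, c)) (proj (x, y, z)) =
    proj (x - c, y - 1, z - dlt (a + c - x) (b + 1 - y))"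
  by (simp add: ybe_sigma_def rr_proj)

lemma ybe_gamma_rr:
  "ybe_gamma (XX m n) (rr m n) (proj (x, y, z)) (proj (a, b, c)) =
    proj (a + z - dlt (a + c - x) (b + 1 - y), b + 1, c + dlt (a + c - x) (b + 1 - y))"
  by (simp add: ybe_gamma_def rr_proj)

lemma bij_betw_ybe_sigma_rr:
  assumes "u \<in> XX m n"
  shows "bij_betw (ybe_sigma (XX m n) (rr m n) u) (XX m n) (XX m n)"
proof -
  have "ybe_sigma (XX m n) (rr m n) u \<in> XX m n \<rightarrow> XX m n"
    using assms by (auto elim!: XX_cases simp: ybe_sigma_rr)
  moreover have "inj_on (ybe_sigma (XX m n) (rr m n) u) (XX m n)"
    using inj_on_sig[OF assms] by (auto simp: inj_on_def ybe_sigma_def rr_def)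
  ultimately show ?thesis
    using endo_inj_surj[OF finite_XX] by (simp add: bij_betw_def image_subset_iff_funcset)
qed

lemma bij_betw_ybe_gamma_rr:
  assumes "v \<in> XX m n"
  shows "bij_betw (ybe_gamma (XX m n) (rr m n) v) (XX m n) (XX m n)"
proof -
  let ?g = "ybe_gamma (XX m n) (rr m n) v"
  have "?g \<in> XX m n \<rightarrow> XX m n"
    using assms by (auto elim!: XX_cases simp: ybe_gamma_rr)
  moreover have "inj_on ?g (XX m n)"
  proof (rule inj_onI)
    fix u u' assume "u \<in> XX m n" "u' \<in> XX m n" and eq: "?g u = ?g u'"
    then obtain a b c a' b' c' x y z
      where p: "u = proj (a, b, c)" "u' = proj (a', b', c')" "v = proj (x, y, z)"
      using assms by (elim XX_cases)
    define d where "d = dlt (a + c - x) (b + 1 - y)"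
    define d' where "d' = dlt (a' + c' - x) (b' + 1 - y)"
    have E: "m dvd (a + z - d) - (a' + z - d')" "n dvd b - b'" "m dvd (c + d) - (c' + d')"
      using eq by (simp_all add: p ybe_gamma_rr proj_eq_iff d_def d'_def)
    \<comment> \<open>the sum of the first and last coordinates is preserved up to \<open>z\<close>, and \<open>d\<close> depends only on it and on \<open>b\<close>\<close>
    have "m dvd (a + c - x) - (a' + c' - x)"
      using dvd_add[OF E(1,3)] by (simp add: algebra_simps)
    then have "d = d'"
      unfolding d_def d'_def by (rule dlt_cong) (use E(2) in simp)
    then show "u = u'"
      using E by (simp add: p proj_eq_iff)
  qed
  ultimately show ?thesis
    using endo_inj_surj[OF finite_XX] by (simp add: bij_betw_def image_subset_iff_funcset)
qed

lemma ybe_solution_rr: "ybe_solution (XX m n) (rr m n)"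
  unfolding ybe_solution_def
proof (intro conjI ballI)
  show "XX m n \<noteq> {}"
    by (simp add: XX_eq_range)
  show "rr m n \<in> XX m n \<times> XX m n \<rightarrow> XX m n \<times> XX m n"
    by (auto elim!: XX_cases simp: rr_proj)
  show "rr m n (rr m n p) = p" if "p \<in> XX m n \<times> XX m n" for p
    using that by (auto elim!: XX_cases simp: rr_involutive)
  show "ybe12 (rr m n) (ybe23 (rr m n) (ybe12 (rr m n) t)) =
      ybe23 (rr m n) (ybe12 (rr m n) (ybe23 (rr m n) t))" if "t \<in> XX m n \<times> XX m n \<times> XX m n" for t
    using that by (auto elim!: XX_cases simp: rr_braid)
qed (simp_all add: bij_betw_ybe_sigma_rr bij_betw_ybe_gamma_rr)

section \<open>Irretractability\<close>

lemma ybe_irretractable_rr: "ybe_irretractable (XX m n) (rr m n)"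
  unfolding ybe_irretractable_def
proof (intro ballI impI notI)
  fix u u'
  assume "u \<in> XX m n" "u' \<in> XX m n" and neq: "u \<noteq> u'"
    and eq: "ybe_sigma (XX m n) (rr m n) u = ybe_sigma (XX m n) (rr m n) u'"
  then obtain a b c a' b' c' where p: "u = proj (a, b, c)" "u' = proj (a', b', c')"
    by (elim XX_cases)
  \<comment> \<open>evaluate at the point \<open>(a + c, b + 1, 0)\<close>, where the Kronecker delta of \<open>u\<close> is \<open>1\<close>\<close>
  have "proj (a, b, - 1) = proj (a + c - c', b, - dlt (a' + c' - (a + c)) (b' - b))"
    using fun_cong[OF eq, of "proj (a + c, b + 1, 0)"] by (simp add: p ybe_sigma_rr dlt_def)
  then have c: "m dvd c' - c" and d: "m dvd dlt (a' + c' - (a + c)) (b' - b) - 1"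
    by (simp_all add: proj_eq_iff algebra_simps)
  \<comment> \<open>As \<open>m > 1\<close> does not divide \<open>-1\<close>, the value of
    \<open>dlt\<close> is \<open>1\<close> and not \<open>0\<close>.\<close>
  have "m dvd a' + c' - (a + c)" "n dvd b' - b"
    using d m by (auto simp: dlt_def split: if_splits)
  moreover from this(1) have "m dvd a' - a"
    using c dvd_diff[of m "a' + c' - (a + c)" "c' - c"] by (simp add: algebra_simps)
  ultimately show False
    using c neq by (simp add: p proj_eq_iff dvd_diff_commute)
qed

section \<open>Indecomposability\<close>

abbreviation step :: "int \<times> int \<times> int \<Rightarrow> int \<times> int \<times> int \<Rightarrow> bool" where
  "step p q \<equiv> \<exists>w\<in>XX m n. q = ybe_sigma (XX m n) (rr m n) w p"

lemma step_proj:
  assumes "e \<in> {0, 1}"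
  shows "step (proj (x, y, z)) (proj (x', y - 1, z - e))"
proof
  \<comment> \<open>The last entry moves \<open>x\<close> to \<open>x'\<close>. The first entry
    agrees with \<open>x'\<close> modulo \<open>m\<close> exactly when \<open>e = 1\<close>, so the
    delta equals \<open>e\<close>.\<close>
  let ?w = "proj (x' + (1 - e), y - 1, x - x')"
  show "?w \<in> XX m n" by simp
  show "proj (x', y - 1, z - e) = ybe_sigma (XX m n) (rr m n) ?w (proj (x, y, z))"
    using assms m by (auto simp: ybe_sigma_rr dlt_def)
qed

lemma steps_proj:
  assumes "j \<le> k"
  shows "step\<^sup>*\<^sup>* (proj (x, y, z)) (proj (x, y - int k, z - int j))"
  using assms
proof (induction k arbitrary: j)
  case (Suc k)
  \<comment> \<open>The last step lowers \<open>z\<close> only if the \<open>k\<close> steps before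
    it cannot supply all \<open>j\<close> decrements.\<close>
  define e where "e = (if j = Suc k then 1 else 0 :: nat)"
  have e: "int e \<in> {0, 1}" "j - e \<le> k" "e \<le> j" using Suc.prems by (auto simp: e_def)
  have "step\<^sup>*\<^sup>* (proj (x, y, z)) (proj (x, y - int k, z - int (j - e)))"
    by (rule Suc.IH) (rule e(2))
  also have "step (proj (x, y - int k, z - int (j - e)))
      (proj (x, y - int k - 1, z - int (j - e) - int e))"
    by (rule step_proj) (rule e(1))
  finally show ?case
    using e(3) by (simp add: algebra_simps)
qed simp

lemma ybe_indecomposable_rr: "ybe_indecomposable (XX m n) (rr m n)"
proof (rule ybe_indecomposableI[OF ybe_solution_rr])
  fix p p' assume "p \<in> XX m n" "p' \<in> XX m n"
  then obtain x y z x' y' z' where p: "p = proj (x, y, z)" "p' = proj (x', y', z')"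
    by (elim XX_cases)
  define j where "j = nat ((z - z') mod m)"
  \<comment> \<open>the summand \<open>n * m\<close> makes room for the \<open>j < m\<close> decrements of the last coordinate\<close>
  define k where "k = nat ((y - 1 - y') mod n + n * m)"
  have j: "int j = (z - z') mod m" and k: "int k = (y - 1 - y') mod n + n * m"
    using m n by (simp_all add: j_def k_def)
  have "(z - z') mod m < m" "m \<le> n * m" "0 \<le> (y - 1 - y') mod n"
    using m n by simp_all
  then have "j \<le> k" using j k by linarith
  \<comment> \<open>One step with \<open>e = 0\<close> sets the first coordinate, which the later
    steps keep. It also lowers \<open>y\<close>, hence the \<open>y - 1\<close> in
    \<open>k\<close>.\<close>
  have "step p (proj (x', y - 1, z))"
    unfolding p using step_proj[of 0 x' y z x] by simp
  also have "step\<^sup>*\<^sup>* (proj (x', y - 1, z)) (proj (x', y - 1 - int k, z - int j))"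
    by (rule steps_proj) fact
  also have "proj (x', y - 1 - int k, z - int j) = p'"
    unfolding p j k proj_eq_iff by (simp add: minus_mult_div_eq_mod[symmetric] algebra_simps)
  finally show "step\<^sup>*\<^sup>* p p'" .
qed

section \<open>The solution on the integers modulo \<open>n\<close> and the epimorphism\<close>

lemma ss_eq: "ss n (i, j) = ((j - 1) mod n, (i + 1) mod n)"
proof -
  have "\<one>\<^bsub>residue_ring n\<^esub> = 1" by (simp add: residue_ring_def)
  then show ?thesis
    using n by (simp add: ss_def residue_ring_minus) (simp add: residue_ring_def)
qed

lemma bij_betw_shift_mod: "bij_betw (\<lambda>j. (j + k) mod n) {0..n - 1} {0..n - 1}"
proof (rule bij_betw_byWitness[where f' = "\<lambda>j. (j - k) mod n"])
qed (use n in \<open>auto simp: mod_simps\<close>)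

lemma ybe_solution_ss: "ybe_solution (carrier (residue_ring n)) (ss n)"
proof -
  let ?C = "carrier (residue_ring n)"
  have C: "?C = {0..n - 1}" by (simp add: residue_ring_def)
  have "bij_betw (ybe_sigma ?C (ss n) i) ?C ?C" "bij_betw (ybe_gamma ?C (ss n) i) ?C ?C" for i
    using bij_betw_shift_mod[of "- 1"] bij_betw_shift_mod[of 1]
    unfolding ybe_sigma_def ybe_gamma_def bij_betw_restrict_eq by (simp_all add: C ss_eq)
  then show ?thesis
    using n by (auto simp: ybe_solution_def C ss_eq ybe12_def ybe23_def mod_simps)
qed

text \<open>Under \<open>rr\<close> the middle coordinates change by \<open>-1\<close> and
  \<open>+1\<close> regardless of the other coordinates, exactly as under \<open>ss\<close>.\<close>

lemma ybe_epimorphism_rr_ss: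
  "ybe_epimorphism (XX m n) (rr m n) (carrier (residue_ring n)) (ss n) (\<lambda>(a, b, c). b)"
  (is "ybe_epimorphism ?X ?r ?C ?s ?f")
proof -
  have C: "?C = {0..n - 1}" by (simp add: residue_ring_def)
  have f: "?f (proj (a, b, c)) = b mod n" for a b c by (simp add: proj_def)
  have "?f ` ?X = ?C"
  proof
    show "?f ` ?X \<subseteq> ?C" by (auto simp: XX_def)
    have "b = ?f (proj (0, b, 0))" if "b \<in> ?C" for b
      using that by (simp add: f C)
    then show "?C \<subseteq> ?f ` ?X" by (metis image_eqI proj_in_XX subsetI)
  qed
  moreover have "?f (ybe_sigma ?X ?r u v) = ybe_sigma ?C ?s (?f u) (?f v) \<and>
      ?f (ybe_gamma ?X ?r v u) = ybe_gamma ?C ?s (?f v) (?f u)"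
    if uv: "u \<in> ?X" "v \<in> ?X" for u v
  proof -
    obtain a b c x y z where p: "u = proj (a, b, c)" "v = proj (x, y, z)"
      using uv by (elim XX_cases)
    have "?f u \<in> ?C" "?f v \<in> ?C" using n by (simp_all add: p f C)
    then show ?thesis
      by (simp add: ybe_sigma_def[of ?C] ybe_gamma_def[of ?C])
        (simp add: p ybe_sigma_rr ybe_gamma_rr f ss_eq mod_simps)
  qed
  ultimately show ?thesis
    using ybe_solution_rr ybe_solution_ss
    by (simp add: ybe_epimorphism_def ybe_homomorphism_def) blast
qed

end

theorem theorem2p2:
  fixes m n :: int
  assumes "m > 1" and "n > 1"
  shows "ybe_solution (XX m n) (rr m n) \<and>
         ybe_indecomposable (XX m n) (rr m n) \<and>
         ybe_irretractable (XX m n) (rr m n) \<and>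
         ybe_epimorphism (XX m n) (rr m n) (carrier (residue_ring n)) (ss n) (\<lambda>(a, b, c). b)"
  using assms
  by (simp add: ybe_solution_rr ybe_indecomposable_rr ybe_irretractable_rr ybe_epimorphism_rr_ss)

end
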